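(* Let $a:(0,\infty)\to(0,\infty)$ be a $C^\infty$ function with $a(r)\to\infty$ as $r\to 0^+$. Then there exists a continuous function $R:\mathbb{R}\to\mathbb{R}$ such that the one-parameter family of differential equations $\dot{x}=R(r)+x^2$, with $x\in\mathbb{R}$ and parameter $r\in\mathbb{R}$, has a saddle-node bifurcation at $r=0$ with no equilibria for $r>0$ and two equilibria for $r<0$, and such that the scaling law for this saddle-node is $$t(r)\sim a(r)\qquad\text{as } r\to 0^+ .$$
   Context: Saddle-node bifurcation (for continuous vector fields): a family $\dot{x}=f(r,x)$ on $\mathbb{R}$ has a saddle-node bifurcation at $(r,x)=(0,0)$ (here: "at $r=0$") if, near $(0,0)$, it is orbitally topologically equivalent to the smooth saddle-node normal form $\dot{x}=r+x^2$. Scaling law: for $r>0$, $t(r)$ denotes the time a trajectory of $\dot{x}=f(r,x)$ spends in the interval $[-1,1]$, passing from $x=-1$ to $x=1$, i.e. $t(r)=\int_{-1}^{1}\frac{dx}{f(r,x)}$. The scaling law is the asymptotic behaviour of $t(r)$ as $r\to 0^+$. Convention: $t(r)\sim a(r)$ as $r\to0^+$ is understood up to a positive multiplicative constant, i.e. $t(r)/a(r)$ tends to a finite positive constant. For example, for $\dot x=r+x^2$ one has $t(r)=2\arctan(1/\sqrt r)/\sqrt r$, which is written $t\sim 1/\sqrt r$. *)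

theory Defs
  imports "HOL-Analysis.Analysis"
begin

text \<open>
  A one-parameter family of vector fields on the line is a function \<open>f\<close> with
  \<open>f r x\<close> the value at \<open>x\<close> of the vector field with parameter \<open>r\<close>.
\<close>

text \<open>The set is meant to be open, so that \<open>deriv\<close> on it depends only on the values there.\<close>

definition smooth_on :: "real set \<Rightarrow> (real \<Rightarrow> real) \<Rightarrow> bool" where
  "smooth_on S a \<longleftrightarrow> (\<forall>n. (deriv ^^ n) a differentiable_on S)"

definition solution_on :: "(real \<Rightarrow> real) \<Rightarrow> real set \<Rightarrow> real set \<Rightarrow> (real \<Rightarrow> real) \<Rightarrow> bool" where
  "solution_on g S I \<phi> \<longleftrightarrow> open I \<and> is_interval I \<and> I \<noteq> {} \<and>
     (\<forall>t\<in>I. \<phi> t \<in> S \<and> (\<phi> has_real_derivative g (\<phi> t)) (at t))"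

text \<open>
  A solution in \<open>S\<close> that cannot be continued within \<open>S\<close>. Its image is an orbit of \<open>g\<close> in \<open>S\<close>,
  oriented by increasing time.
\<close>

definition trajectory :: "(real \<Rightarrow> real) \<Rightarrow> real set \<Rightarrow> real set \<Rightarrow> (real \<Rightarrow> real) \<Rightarrow> bool" where
  "trajectory g S I \<phi> \<longleftrightarrow> solution_on g S I \<phi> \<and>
     (\<forall>J \<psi>. solution_on g S J \<psi> \<and> I \<subseteq> J \<and> (\<forall>t\<in>I. \<psi> t = \<phi> t) \<longrightarrow> J = I)"

text \<open>
  \<open>h\<close> carries the first trajectory onto the second up to an increasing change of time, which
  is not required to preserve the speed.
\<close>

definition carries ::
  "(real \<Rightarrow> real) \<Rightarrow> real set \<Rightarrow> (real \<Rightarrow> real) \<Rightarrow> real set \<Rightarrow> (real \<Rightarrow> real) \<Rightarrow> bool" where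
  "carries h I \<phi> J \<psi> \<longleftrightarrow>
     (\<exists>\<tau>. strict_mono_on I \<tau> \<and> \<tau> ` I = J \<and> (\<forall>t\<in>I. h (\<phi> t) = \<psi> (\<tau> t)))"

definition maps_orbits_to_orbits ::
  "(real \<Rightarrow> real) \<Rightarrow> real set \<Rightarrow> (real \<Rightarrow> real) \<Rightarrow> real set \<Rightarrow> (real \<Rightarrow> real) \<Rightarrow> bool" where
  "maps_orbits_to_orbits h S g T k \<longleftrightarrow>
     (\<forall>I \<phi>. trajectory g S I \<phi> \<longrightarrow> (\<exists>J \<psi>. trajectory k T J \<psi> \<and> carries h I \<phi> J \<psi>)) \<and>
     (\<forall>J \<psi>. trajectory k T J \<psi> \<longrightarrow> (\<exists>I \<phi>. trajectory g S I \<phi> \<and> carries h I \<phi> J \<psi>))"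

text \<open>
  Local equivalence near \<open>(r, x) = (0, 0)\<close>: a homeomorphism \<open>(r, x) \<mapsto> (p r, h r x)\<close> between open
  neighbourhoods \<open>U\<close> and \<open>V\<close> of the origin, over a homeomorphism \<open>p\<close> of the parameters,
  which takes the orbits of \<open>f r\<close> to those of \<open>g (p r)\<close>. The orbits are those in the slices
  \<open>{x. (r, x) \<in> U}\<close> and \<open>{y. (p r, y) \<in> V}\<close>. The homeomorphism \<open>p\<close> may reverse the orientation of
  the parameter line.
\<close>

definition locally_orbitally_equivalent ::
  "(real \<Rightarrow> real \<Rightarrow> real) \<Rightarrow> (real \<Rightarrow> real \<Rightarrow> real) \<Rightarrow> bool" where
  "locally_orbitally_equivalent f g \<longleftrightarrow>
     (\<exists>U V p h. open U \<and> (0, 0) \<in> U \<and> open V \<and> (0, 0) \<in> V \<and> p 0 = 0 \<and> h 0 0 = 0 \<and>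
        (\<exists>q. homeomorphism (fst ` U) (fst ` V) p q) \<and>
        (\<exists>K. homeomorphism U V (\<lambda>(r, x). (p r, h r x)) K) \<and>
        (\<forall>r \<in> fst ` U.
           maps_orbits_to_orbits (h r) {x. (r, x) \<in> U} (f r) {y. (p r, y) \<in> V} (g (p r))))"

definition has_saddle_node_bifurcation :: "(real \<Rightarrow> real \<Rightarrow> real) \<Rightarrow> bool" where
  "has_saddle_node_bifurcation f \<longleftrightarrow>
     continuous_on UNIV (\<lambda>(r, x). f r x) \<and>
     locally_orbitally_equivalent f (\<lambda>r x. r + x\<^sup>2)"

definition equilibria :: "(real \<Rightarrow> real) \<Rightarrow> real set" where
  "equilibria g = {x. g x = 0}"

definition transit_time :: "(real \<Rightarrow> real \<Rightarrow> real) \<Rightarrow> real \<Rightarrow> real" where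
  "transit_time f r = integral {-1..1} (\<lambda>x. 1 / f r x)"

text \<open>
  The relation \<open>t(r) \<sim> a(r)\<close> as \<open>r \<rightarrow> 0+\<close>, up to a positive multiplicative constant; the library
  relation \<open>asymp_equiv\<close> would force the constant to be 1.
\<close>

definition has_scaling_law :: "(real \<Rightarrow> real \<Rightarrow> real) \<Rightarrow> (real \<Rightarrow> real) \<Rightarrow> bool" where
  "has_scaling_law f a \<longleftrightarrow>
     (\<exists>c>0. ((\<lambda>r. transit_time f r / a r) \<longlongrightarrow> c) (at_right 0))"

end

theory Submission
  imports Defs
begin

text \<open>
  Put \<open>R r = 1 / (a r)\<^sup>2\<close> for \<open>r > 0\<close> and \<open>R r = r\<close> for \<open>r \<le> 0\<close>. The transit time is then exactly
  \<open>2 a(r) arctan a(r)\<close>, which is asymptotic to \<open>\<pi> a(r)\<close>. Since \<open>a\<close> may oscillate, \<open>R\<close> need not be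
  injective and cannot serve as the change of parameter; but the identity of the whole plane
  is already an orbital equivalence with the normal form. For \<open>r \<le> 0\<close> the two fields coincide, and
  for \<open>r > 0\<close> each of them has a single orbit, the whole line, traversed in the same direction.
\<close>

text \<open>Separating variables in x' = s^2 + x^2 leads to this scaled tangent. The time window is
  the branch of length pi / s around \<open>c\<close> on which the cosine is nonzero, and the
  equation is then tan' = 1 + tan^2 after scaling.\<close>

lemma scaled_tan_has_derivative:
  fixes s :: real
  assumes "s > 0" and "t \<in> {c - pi / (2 * s)<..<c + pi / (2 * s)}"
  shows "((\<lambda>t. s * tan (s * (t - c))) has_real_derivative s\<^sup>2 + (s * tan (s * (t - c)))\<^sup>2) (at t)"
proof -
  have "- (pi / 2) < s * (t - c)" "s * (t - c) < pi / 2"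
    using assms by (auto simp: field_simps)
  then have nz: "cos (s * (t - c)) \<noteq> 0"
    using cos_gt_zero_pi by (metis less_irrefl)
  have sec: "inverse ((cos (s * (t - c)))\<^sup>2) = 1 + (tan (s * (t - c)))\<^sup>2"
    using tan_sec[OF nz] by (simp add: power_inverse)
  have "((\<lambda>t. s * (t - c)) has_real_derivative s) (at t)"
    by (auto intro!: derivative_eq_intros)
  then have "((\<lambda>t. s * tan (s * (t - c))) has_real_derivative
      s * (inverse ((cos (s * (t - c)))\<^sup>2) * s)) (at t)"
    by (intro DERIV_cmult DERIV_chain2[where f = tan] DERIV_tan[OF nz])
  then show ?thesis
    unfolding sec by (simp add: power2_eq_square algebra_simps)
qed

text \<open>The function \<open>arctan (\<phi> t / s) / s\<close> has derivative 1, so it differs from \<open>t\<close> by a constant.\<close>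

lemma solution_eq_scaled_tan:
  fixes s :: real
  assumes "s > 0" and sol: "solution_on (\<lambda>x. s\<^sup>2 + x\<^sup>2) UNIV I \<phi>"
  obtains c where "I \<subseteq> {c - pi / (2 * s)<..<c + pi / (2 * s)}"
    and "\<And>t. t \<in> I \<Longrightarrow> \<phi> t = s * tan (s * (t - c))"
proof -
  have conv: "convex I" and ne: "I \<noteq> {}"
    and der: "\<And>t. t \<in> I \<Longrightarrow> (\<phi> has_real_derivative s\<^sup>2 + (\<phi> t)\<^sup>2) (at t)"
    using sol by (auto simp: solution_on_def is_interval_convex)
  have "((\<lambda>t. arctan (\<phi> t / s) / s - t) has_real_derivative 0) (at t within I)" if "t \<in> I" for t
  proof -
    have pos: "s\<^sup>2 + (\<phi> t)\<^sup>2 > 0"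
      using \<open>s > 0\<close> by (simp add: add_pos_nonneg)
    \<comment> \<open>In this form the denominator of the arctan derivative cancels the velocity
      along \<phi>, leaving exactly 1.\<close>
    have "1 + (\<phi> t / s)\<^sup>2 = (s\<^sup>2 + (\<phi> t)\<^sup>2) / s\<^sup>2"
      using \<open>s > 0\<close> by (simp add: field_simps)
    then have "inverse (1 + (\<phi> t / s)\<^sup>2) * ((s\<^sup>2 + (\<phi> t)\<^sup>2) / s) / s - 1 = 0"
      using \<open>s > 0\<close> pos by (simp add: power2_eq_square)
    moreover have "((\<lambda>t. arctan (\<phi> t / s) / s - t) has_real_derivative
        inverse (1 + (\<phi> t / s)\<^sup>2) * ((s\<^sup>2 + (\<phi> t)\<^sup>2) / s) / s - 1) (at t)"
      by (intro DERIV_diff DERIV_cdivide DERIV_ident DERIV_chain2[OF DERIV_arctan] der that)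
    ultimately show ?thesis
      by (metis has_field_derivative_at_within)
  qed
  \<comment> \<open>Since \<open>I\<close> is an interval, one constant \<open>d\<close> serves for
    all of it; the centre of the tangent branch is then \<open>- d\<close>.\<close>
  from has_field_derivative_zero_constant[OF conv this]
  obtain d where d: "\<And>t. t \<in> I \<Longrightarrow> arctan (\<phi> t / s) / s - t = d"
    by blast
  have arc: "arctan (\<phi> t / s) = s * (t - - d)" if "t \<in> I" for t
    using d[OF that] \<open>s > 0\<close> by (simp add: field_simps)
  show thesis
  proof
    \<comment> \<open>The bounds of arctan by pi / 2 limit the lifetime of every solution to a
      window of length pi / s.\<close>
    show "I \<subseteq> {- d - pi / (2 * s)<..<- d + pi / (2 * s)}"
    proof
      fix t assume "t \<in> I"
      then show "t \<in> {- d - pi / (2 * s)<..<- d + pi / (2 * s)}"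
        using arctan_bounded[of "\<phi> t / s"] \<open>s > 0\<close> by (auto simp: arc field_simps)
    qed
    show "\<phi> t = s * tan (s * (t - - d))" if "t \<in> I" for t
      using tan_arctan[of "\<phi> t / s"] \<open>s > 0\<close> by (simp only: arc[OF that] field_simps)
  qed
qed

lemma scaled_tan_solution:
  fixes s :: real
  assumes "s > 0"
  shows "solution_on (\<lambda>x. s\<^sup>2 + x\<^sup>2) UNIV {c - pi / (2 * s)<..<c + pi / (2 * s)}
           (\<lambda>t. s * tan (s * (t - c)))"
proof -
  have "pi / (2 * s) > 0"
    using assms by simp
  then have "c \<in> {c - pi / (2 * s)<..<c + pi / (2 * s)}"
    by simp
  then show ?thesis
    using scaled_tan_has_derivative[OF assms]
    unfolding solution_on_def by (auto simp: is_interval_convex)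
qed

text \<open>Any extension is again a solution, so its domain lies in some window of the same length
  pi / s. Two nested windows of equal length have the same centre, which leaves no room to
  extend.\<close>

lemma scaled_tan_trajectory:
  fixes s :: real
  assumes "s > 0"
  shows "trajectory (\<lambda>x. s\<^sup>2 + x\<^sup>2) UNIV {c - pi / (2 * s)<..<c + pi / (2 * s)}
           (\<lambda>t. s * tan (s * (t - c)))"
  unfolding trajectory_def
proof (intro conjI allI impI scaled_tan_solution[OF assms], elim conjE)
  fix J \<psi>
  let ?r = "pi / (2 * s)"
  assume "solution_on (\<lambda>x. s\<^sup>2 + x\<^sup>2) UNIV J \<psi>" and sub: "{c - ?r<..<c + ?r} \<subseteq> J"
  then obtain c' where J: "J \<subseteq> {c' - ?r<..<c' + ?r}"
    using solution_eq_scaled_tan[OF assms] by metis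
  \<comment> \<open>Nonemptiness allows the endpoint inequalities to be read off from the
    inclusion.\<close>
  have "c - ?r < c + ?r"
    using assms by simp
  then have "c' - ?r \<le> c - ?r \<and> c + ?r \<le> c' + ?r"
    using greaterThanLessThan_subseteq_greaterThanLessThan[of "c - ?r" "c + ?r" "c' - ?r" "c' + ?r"]
      order_trans[OF sub J] by auto
  then have "c' = c"
    by linarith
  with sub J show "J = {c - ?r<..<c + ?r}"
    by auto
qed

text \<open>Maximality forces the domain to be a full branch of the tangent, which increases from
  minus infinity to infinity. Hence the line is a single orbit, run through to the right.\<close>

lemma trajectory_onto_line:
  fixes s :: real
  assumes "s > 0" and traj: "trajectory (\<lambda>x. s\<^sup>2 + x\<^sup>2) UNIV I \<phi>"
  shows "strict_mono_on I \<phi>" and "\<phi> ` I = UNIV"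
proof -
  have sol: "solution_on (\<lambda>x. s\<^sup>2 + x\<^sup>2) UNIV I \<phi>"
    and max: "\<And>J \<psi>. solution_on (\<lambda>x. s\<^sup>2 + x\<^sup>2) UNIV J \<psi> \<Longrightarrow> I \<subseteq> J \<Longrightarrow>
      (\<forall>t\<in>I. \<psi> t = \<phi> t) \<Longrightarrow> J = I"
    using traj unfolding trajectory_def by blast+
  obtain c where sub: "I \<subseteq> {c - pi / (2 * s)<..<c + pi / (2 * s)}"
    and eq: "\<And>t. t \<in> I \<Longrightarrow> \<phi> t = s * tan (s * (t - c))"
    using solution_eq_scaled_tan[OF assms(1) sol] by blast
  \<comment> \<open>The tangent on the whole window extends \<phi>, so maximality of \<phi>
    identifies the two domains.\<close>
  have I: "I = {c - pi / (2 * s)<..<c + pi / (2 * s)}"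
    using max[OF scaled_tan_solution[OF assms(1)] sub] eq by simp
  show "strict_mono_on I \<phi>"
  proof (rule strict_mono_onI)
    fix t u assume tu: "t \<in> I" "u \<in> I" "t < u"
    then have "- (pi / 2) < s * (t - c)" "s * (t - c) < s * (u - c)" "s * (u - c) < pi / 2"
      using assms(1) by (auto simp: I field_simps)
    then have "tan (s * (t - c)) < tan (s * (u - c))"
      by (rule tan_monotone)
    then show "\<phi> t < \<phi> u"
      using tu assms(1) by (simp add: eq)
  qed
  have "y \<in> \<phi> ` I" for y
  proof
    show t: "c + arctan (y / s) / s \<in> I"
      using divide_strict_right_mono[OF arctan_lbound[of "y / s"] assms(1)]
        divide_strict_right_mono[OF arctan_ubound[of "y / s"] assms(1)] by (simp add: I)
    show "y = \<phi> (c + arctan (y / s) / s)"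
      using assms(1) by (simp only: eq[OF t]) (simp add: tan_arctan)
  qed
  then show "\<phi> ` I = UNIV"
    by auto
qed

text \<open>The change of time is the inverse of \<psi> composed with \<phi>. It is defined because
  the images agree, and increasing because both maps are.\<close>

lemma carries_id_of_same_image:
  assumes "strict_mono_on I \<phi>" "strict_mono_on J \<psi>" and img: "\<phi> ` I = \<psi> ` J"
  shows "carries (\<lambda>x. x) I \<phi> J \<psi>"
proof -
  let ?\<tau> = "\<lambda>t. the_inv_into J \<psi> (\<phi> t)"
  have inj: "inj_on \<psi> J"
    using assms(2) by (rule strict_mono_on_imp_inj_on)
  have mem: "?\<tau> t \<in> J" and eq: "\<psi> (?\<tau> t) = \<phi> t" if "t \<in> I" for t
    using the_inv_into_into[OF inj, of "\<phi> t" J] f_the_inv_into_f[OF inj, of "\<phi> t"] img that by auto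
  have "strict_mono_on I ?\<tau>"
  proof (rule strict_mono_onI)
    fix t u assume "t \<in> I" "u \<in> I" "t < u"
    then have "\<psi> (?\<tau> t) < \<psi> (?\<tau> u)"
      using strict_mono_onD[OF assms(1)] by (simp add: eq)
    then show "?\<tau> t < ?\<tau> u"
      using strict_mono_on_less[OF assms(2)] mem \<open>t \<in> I\<close> \<open>u \<in> I\<close> by blast
  qed
  moreover have "?\<tau> ` I = the_inv_into J \<psi> ` \<psi> ` J"
    using img by (metis image_image)
  ultimately show ?thesis
    using eq inj unfolding carries_def
    by (intro exI[of _ ?\<tau>]) (auto simp: the_inv_into_onto image_image the_inv_into_f_f)
qed

lemma maps_orbits_to_orbits_refl: "maps_orbits_to_orbits (\<lambda>x. x) S g S g"
proof -
  have "carries (\<lambda>x. x) I \<phi> I \<phi>" for I \<phi>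
    unfolding carries_def by (intro exI[of _ "\<lambda>t. t"]) (auto simp: strict_mono_on_def)
  then show ?thesis
    unfolding maps_orbits_to_orbits_def by blast
qed

text \<open>With \<open>s\<close> the square root of the parameter, every trajectory on either side
  sweeps out the line increasingly, so any two of them match. The tangent solutions guarantee that
  each side has a trajectory to offer as partner.\<close>

lemma maps_orbits_to_orbits_no_equilibria:
  fixes \<rho> \<sigma> :: real
  assumes "\<rho> > 0" "\<sigma> > 0"
  shows "maps_orbits_to_orbits (\<lambda>x. x) UNIV (\<lambda>x. \<rho> + x\<^sup>2) UNIV (\<lambda>x. \<sigma> + x\<^sup>2)"
proof -
  have sq: "\<rho> = (sqrt \<rho>)\<^sup>2" "\<sigma> = (sqrt \<sigma>)\<^sup>2" and pos: "sqrt \<rho> > 0" "sqrt \<sigma> > 0"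
    using assms by auto
  have "carries (\<lambda>x. x) I \<phi> J \<psi>"
    if "trajectory (\<lambda>x. \<rho> + x\<^sup>2) UNIV I \<phi>" "trajectory (\<lambda>x. \<sigma> + x\<^sup>2) UNIV J \<psi>" for I \<phi> J \<psi>
    using trajectory_onto_line[OF pos(1), of I \<phi>] trajectory_onto_line[OF pos(2), of J \<psi>]
      that sq by (intro carries_id_of_same_image) auto
  moreover have "\<exists>I \<phi>. trajectory (\<lambda>x. \<rho> + x\<^sup>2) UNIV I \<phi>" "\<exists>J \<psi>. trajectory (\<lambda>x. \<sigma> + x\<^sup>2) UNIV J \<psi>"
    using scaled_tan_trajectory[OF pos(1)] scaled_tan_trajectory[OF pos(2)] sq by auto
  ultimately show ?thesis
    unfolding maps_orbits_to_orbits_def by blast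
qed

text \<open>Both neighbourhoods are the whole plane, so all slices are the full line. The parameter
  map is the identity rather than \<open>R\<close>, so for r > 0 only the sign of \<open>R r\<close>
  enters the comparison of orbits.\<close>

lemma has_saddle_node_bifurcation_quadratic:
  assumes cont: "continuous_on UNIV R"
    and pos: "\<And>r. r > 0 \<Longrightarrow> R r > 0" and nonpos: "\<And>r. r \<le> 0 \<Longrightarrow> R r = r"
  shows "has_saddle_node_bifurcation (\<lambda>r x. R r + x\<^sup>2)"
proof -
  have "continuous_on UNIV (\<lambda>(r, x::real). R r + x\<^sup>2)"
    unfolding case_prod_unfold
    by (intro continuous_intros continuous_on_compose2[OF cont]) auto
  moreover have "maps_orbits_to_orbits (\<lambda>x. x) UNIV (\<lambda>x. R r + x\<^sup>2) UNIV (\<lambda>x. r + x\<^sup>2)" for r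
  proof (cases "r > 0")
    case True
    then show ?thesis
      by (intro maps_orbits_to_orbits_no_equilibria pos)
  next
    case False
    then show ?thesis
      using maps_orbits_to_orbits_refl[of UNIV "\<lambda>x. r + x\<^sup>2"] by (simp add: nonpos)
  qed
  moreover have "homeomorphism UNIV UNIV (\<lambda>r. r) (\<lambda>r::real. r)"
    "homeomorphism UNIV UNIV (\<lambda>(r, x). (r, x)) (\<lambda>z::real \<times> real. z)"
    by (auto simp: homeomorphism_def case_prod_unfold)
  ultimately show ?thesis
    unfolding has_saddle_node_bifurcation_def locally_orbitally_equivalent_def
    by (intro conjI exI[of _ UNIV] exI[of _ "\<lambda>r. r"] exI[of _ "\<lambda>r x. x"]) auto
qed

text \<open>The integrand equals s^2 / (1 + (s x)^2), with antiderivative s arctan (s x), an odd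
  function of x.\<close>

lemma transit_time_quadratic:
  fixes s :: real
  assumes "s > 0" and "R r = inverse s ^ 2"
  shows "transit_time (\<lambda>r x. R r + x\<^sup>2) r = 2 * s * arctan s"
proof -
  have "((\<lambda>x. s * arctan (s * x)) has_real_derivative 1 / (R r + x\<^sup>2)) (at x)" for x
  proof -
    have "1 + (s * x)\<^sup>2 > 0"
      by (simp add: add_pos_nonneg)
    moreover have "R r + x\<^sup>2 = (1 + (s * x)\<^sup>2) / s\<^sup>2"
      using assms by (simp add: field_simps)
    ultimately have "1 / (R r + x\<^sup>2) = s * (inverse (1 + (s * x)\<^sup>2) * s)"
      by (simp add: power2_eq_square divide_inverse)
    moreover have "((\<lambda>x. s * arctan (s * x)) has_real_derivative
        s * (inverse (1 + (s * x)\<^sup>2) * s)) (at x)"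
      by (intro DERIV_cmult DERIV_chain2[OF DERIV_arctan] DERIV_cmult_Id)
    ultimately show ?thesis
      by simp
  qed
  then have "((\<lambda>x. 1 / (R r + x\<^sup>2)) has_integral s * arctan (s * 1) - s * arctan (s * (- 1))) {-1..1}"
    by (intro fundamental_theorem_of_calculus)
      (auto simp: has_real_derivative_iff_has_vector_derivative[symmetric]
        intro: has_field_derivative_at_within)
  then show ?thesis
    by (simp add: transit_time_def integral_unique arctan_minus)
qed

theorem proposition3p1:
  fixes a :: "real \<Rightarrow> real"
  assumes "smooth_on {0<..} a"
    and "\<And>r. r > 0 \<Longrightarrow> a r > 0"
    and "filterlim a at_top (at_right 0)"
  shows "\<exists>R :: real \<Rightarrow> real.
    continuous_on UNIV R \<and>
    has_saddle_node_bifurcation (\<lambda>r x. R r + x\<^sup>2) \<and>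
    (\<forall>r>0. equilibria (\<lambda>x. R r + x\<^sup>2) = {}) \<and>
    (\<forall>r<0. card (equilibria (\<lambda>x. R r + x\<^sup>2)) = 2) \<and>
    has_scaling_law (\<lambda>r x. R r + x\<^sup>2) a"
proof (intro exI conjI allI impI)
  \<comment> \<open>The field R + x^2 with R > 0 has transit time 2 arctan (1 / sqrt R) / sqrt R;
    solving 1 / sqrt R = a gives the branch for r > 0.\<close>
  define R where "R = (\<lambda>r. if r \<le> 0 then r else inverse (a r) ^ 2)"
  have Rpos: "R r > 0" if "r > 0" for r
    using assms(2)[OF that] that by (simp add: R_def)
  have Rnonpos: "R r = r" if "r \<le> 0" for r
    using that by (simp add: R_def)

  \<comment> \<open>The derivative of order 0 is \<open>a\<close> itself, so this instance of
    smoothness yields its continuity.\<close>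
  have "((deriv ^^ 0) a) differentiable_on {0<..}"
    using assms(1) unfolding smooth_on_def by blast
  then have "continuous_on {0<..} a"
    by (simp add: differentiable_imp_continuous_on)
  then have "continuous_on {0<..} (\<lambda>r. inverse (a r) ^ 2)"
    using assms(2) by (intro continuous_intros) (auto simp: less_imp_neq[symmetric])
  then have right: "isCont R r" if "r > 0" for r
    using that continuous_on_eq_continuous_at[of "{0<..}" R]
    by (simp add: R_def cong: continuous_on_cong_simp)
  have "continuous_on {..<0} R"
    by (simp add: R_def continuous_on_id cong: continuous_on_cong_simp)
  then have left: "isCont R r" if "r < 0" for r
    using that by (simp add: continuous_on_eq_continuous_at)
  \<comment> \<open>The divergence of \<open>a\<close> at 0 makes the two branches of
    \<open>R\<close> meet continuously there.\<close>
  have "((\<lambda>r. inverse (a r) ^ 2) \<longlongrightarrow> 0 ^ 2) (at_right 0)"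
    by (intro tendsto_power tendsto_inverse_0_at_top assms(3))
  moreover have "eventually (\<lambda>r. inverse (a r) ^ 2 = R r) (at_right 0)"
    by (auto simp: eventually_at_right_field R_def intro: exI[of _ 1])
  ultimately have "(R \<longlongrightarrow> 0) (at_right 0)"
    using Lim_transform_eventually by fastforce
  moreover have "(R \<longlongrightarrow> 0) (at_left 0)"
    by (rule Lim_transform_eventually[OF tendsto_ident_at])
      (auto simp: eventually_at_left_field R_def intro: exI[of _ "-1"])
  ultimately have "isCont R 0"
    by (simp add: isCont_def filterlim_at_split R_def)
  with left right show cont: "continuous_on UNIV R"
    by (metis continuous_at_imp_continuous_on linorder_neqE_linordered_idom)
  show "has_saddle_node_bifurcation (\<lambda>r x. R r + x\<^sup>2)"
    by (intro has_saddle_node_bifurcation_quadratic cont Rpos Rnonpos)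

  show "equilibria (\<lambda>x. R r + x\<^sup>2) = {}" if "r > 0" for r
    using Rpos[OF that] by (auto simp: equilibria_def add_pos_nonneg less_imp_neq[symmetric])
  show "card (equilibria (\<lambda>x. R r + x\<^sup>2)) = 2" if "r < 0" for r
  proof -
    have "x\<^sup>2 = - r \<longleftrightarrow> x = sqrt (- r) \<or> x = - sqrt (- r)" for x
      using power2_eq_iff[of x "sqrt (- r)"] that by simp
    then have "equilibria (\<lambda>x. R r + x\<^sup>2) = {sqrt (- r), - sqrt (- r)}"
      using that by (auto simp: equilibria_def Rnonpos add_eq_0_iff)
    then show ?thesis
      using that by simp
  qed

  \<comment> \<open>The quotient of transit time and \<open>a r\<close> is exactly 2 arctan (a r),
    so the constant of the scaling law is pi.\<close>
  have "((\<lambda>r. 2 * arctan (a r)) \<longlongrightarrow> 2 * (pi / 2)) (at_right 0)"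
    by (intro tendsto_mult tendsto_const filterlim_compose[OF tendsto_arctan_at_top assms(3)])
  moreover have "2 * arctan (a r) = transit_time (\<lambda>r x. R r + x\<^sup>2) r / a r" if "r > 0" for r
    using transit_time_quadratic[of "a r" R r] assms(2)[OF that] that by (simp add: R_def)
  then have "eventually (\<lambda>r. 2 * arctan (a r) = transit_time (\<lambda>r x. R r + x\<^sup>2) r / a r) (at_right 0)"
    by (auto simp: eventually_at_right_field intro: exI[of _ 1])
  ultimately have "((\<lambda>r. transit_time (\<lambda>r x. R r + x\<^sup>2) r / a r) \<longlongrightarrow> pi) (at_right 0)"
    using Lim_transform_eventually by fastforce
  then show "has_scaling_law (\<lambda>r x. R r + x\<^sup>2) a"
    unfolding has_scaling_law_def using pi_gt_zero by blast
qed

end
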